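(* Let $\lambda>0$ be a real number, let $\varphi:[0,+\infty)\to(0,+\infty)$ be a nonincreasing function, and let $t_0:=\frac{\pi}{2\lambda}$. Then there exists a function $\delta:[0,+\infty)\to[0,+\infty)$ such that every solution $u:[0,+\infty)\to\mathbb{R}$ to $$u''(t)+2\delta(t)u'(t)+\lambda^2u(t)=0$$ satisfies $$|u'(t)|^2+\lambda^2|u(t)|^2\le\left(|u'(0)|^2+\lambda^2|u(0)|^2\right)\cdot\varphi(t)\qquad\forall t\ge t_0.$$ Moreover, $\delta$ can be chosen of class $C^\infty$, and it can alternatively be chosen piecewise constant (i.e. there exist both a $C^\infty$ function $\delta:[0,+\infty)\to[0,+\infty)$ and a piecewise constant function $\delta:[0,+\infty)\to[0,+\infty)$, each of which is such that every solution $u$ to $u''(t)+2\delta(t)u'(t)+\lambda^2u(t)=0$ satisfies $|u'(t)|^2+\lambda^2|u(t)|^2\le\left(|u'(0)|^2+\lambda^2|u(0)|^2\right)\cdot\varphi(t)$ for every $t\ge t_0$).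
   Context: Piecewise constant means having finitely many constancy intervals on each bounded interval. When $\delta$ is not continuous, a solution is a function $u\in C^1([0,+\infty))$ with $u'$ locally absolutely continuous that satisfies the equation for almost every $t$. *)

theory Defs
  imports "HOL-Analysis.Analysis"
begin

text \<open>Functions on $[0,+\infty)$ are total functions on the reals of which only the
  restriction to \<open>{0..}\<close> matters. Derivatives are taken within \<open>{0..}\<close>, hence one-sided at \<open>0\<close>.\<close>

definition hderiv :: "(real \<Rightarrow> real) \<Rightarrow> real \<Rightarrow> real" where
  "hderiv f t = vector_derivative f (at t within {0..})"

definition smooth_halfline :: "(real \<Rightarrow> real) \<Rightarrow> bool" where
  "smooth_halfline f \<longleftrightarrow> (\<forall>n. ((hderiv ^^ n) f) differentiable_on {0..})"

definition piecewise_constant_halfline :: "(real \<Rightarrow> real) \<Rightarrow> bool" where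
  "piecewise_constant_halfline f \<longleftrightarrow>
     (\<forall>J. is_interval J \<and> bounded J \<and> J \<subseteq> {0..} \<longrightarrow>
        (\<exists>\<I>. finite \<I> \<and> \<Union>\<I> = J \<and> (\<forall>I\<in>\<I>. is_interval I \<and> f constant_on I)))"

text \<open>A division \<open>\<D>\<close> of a subset of \<open>{a..b}\<close> is a finite family of non-overlapping compact
  nonempty intervals \<open>k = {Inf k..Sup k}\<close>.\<close>

definition abs_continuous_interval :: "real \<Rightarrow> real \<Rightarrow> (real \<Rightarrow> real) \<Rightarrow> bool" where
  "abs_continuous_interval a b f \<longleftrightarrow>
     (\<forall>\<epsilon>>0. \<exists>\<eta>>0. \<forall>\<D> S. \<D> division_of S \<and> S \<subseteq> {a..b} \<and> (\<Sum>k\<in>\<D>. Sup k - Inf k) < \<eta> \<longrightarrow>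
        (\<Sum>k\<in>\<D>. \<bar>f (Sup k) - f (Inf k)\<bar>) < \<epsilon>)"

definition locally_abs_continuous_halfline :: "(real \<Rightarrow> real) \<Rightarrow> bool" where
  "locally_abs_continuous_halfline f \<longleftrightarrow> (\<forall>a\<ge>0. \<forall>b\<ge>a. abs_continuous_interval a b f)"

definition classical_solution :: "real \<Rightarrow> (real \<Rightarrow> real) \<Rightarrow> (real \<Rightarrow> real) \<Rightarrow> bool" where
  "classical_solution lam \<delta> u \<longleftrightarrow>
     u differentiable_on {0..} \<and> hderiv u differentiable_on {0..} \<and>
     (\<forall>t\<ge>0. hderiv (hderiv u) t + 2 * \<delta> t * hderiv u t + lam\<^sup>2 * u t = 0)"

definition ae_solution :: "real \<Rightarrow> (real \<Rightarrow> real) \<Rightarrow> (real \<Rightarrow> real) \<Rightarrow> bool" where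
  "ae_solution lam \<delta> u \<longleftrightarrow>
     u differentiable_on {0..} \<and> continuous_on {0..} (hderiv u) \<and>
     locally_abs_continuous_halfline (hderiv u) \<and>
     (AE t in lebesgue. 0 \<le> t \<longrightarrow>
        hderiv u differentiable (at t within {0..}) \<and>
        hderiv (hderiv u) t + 2 * \<delta> t * hderiv u t + lam\<^sup>2 * u t = 0)"

definition damped_solution :: "real \<Rightarrow> (real \<Rightarrow> real) \<Rightarrow> (real \<Rightarrow> real) \<Rightarrow> bool" where
  "damped_solution lam \<delta> u \<longleftrightarrow>
     (if continuous_on {0..} \<delta> then classical_solution lam \<delta> u else ae_solution lam \<delta> u)"

definition decays_at_rate ::
    "real \<Rightarrow> (real \<Rightarrow> real) \<Rightarrow> real \<Rightarrow> (real \<Rightarrow> real) \<Rightarrow> bool" where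
  "decays_at_rate lam \<phi> t\<^sub>0 \<delta> \<longleftrightarrow>
     (\<forall>u. damped_solution lam \<delta> u \<longrightarrow>
        (\<forall>t\<ge>t\<^sub>0. \<bar>hderiv u t\<bar>\<^sup>2 + lam\<^sup>2 * \<bar>u t\<bar>\<^sup>2
               \<le> (\<bar>hderiv u 0\<bar>\<^sup>2 + lam\<^sup>2 * \<bar>u 0\<bar>\<^sup>2) * \<phi> t))"

end

theory Submission
  imports Defs
begin

text \<open>Divide the half-line into blocks of length $\pi/(2\lambda)$. In each block the damping consists of
  two short strong bursts, at the two ends, and vanishes in between. A burst essentially kills the
  velocity without moving the position. In between, the phase point rotates by an angle close to
  $\pi/2$, which turns the surviving position into velocity, and this is killed by the second burst.
  Hence a single block multiplies the energy by an arbitrarily small factor. Since the energy never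
  increases, it suffices that the block ending at time $(n+1)\pi/(2\lambda)$ reduces it by the factor
  $\varphi((n+2)\pi/(2\lambda))$.\<close>

section \<open>Absolutely continuous functions\<close>

text \<open>For discontinuous damping the equation holds only almost everywhere, so u'' need not
  exist at a given time. The remedy is a fundamental theorem of calculus for absolutely continuous
  functions: on an interval where the damping agrees with a continuous function, u' is the integral
  of a continuous function, and classical arguments apply. One construction then serves the smooth
  and the piecewise constant case; only the bump profile changes.

  All errors in a block are measured by one parameter s. A burst has length at most s / lam and
  integral at least 1 / (2 * s), so it leaves a velocity of at most 2 * s times the root of the
  energy. The two bursts shorten the free rotation by an angle of at most 2 * s. Both phase
  coordinates end below 5 * s times the root of the initial energy, whence the factor 50 * s^2 for
  the energy itself.

  The index n + 2 appears because the reduction achieved by block n must serve throughout the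
  following block, and a nonincreasing \<phi> is smallest at its right end.\<close>

lemma division_sum_length:
  fixes \<D> :: "real set set"
  assumes "\<D> division_of S"
  shows "(\<Sum>k\<in>\<D>. Sup k - Inf k) = measure lebesgue S"
proof -
  have box: "\<exists>c d. k = {c..d} \<and> c \<le> d" if k: "k \<in> \<D>" for k
    using division_ofD(3,4)[OF assms k] by (metis atLeastatMost_empty_iff2 box_real(2))
  have "measure lebesgue S = (\<Sum>k\<in>\<D>. measure lebesgue k)"
    using content_division[OF assms] by simp
  also have "\<dots> = (\<Sum>k\<in>\<D>. Sup k - Inf k)"
  proof (rule sum.cong)
    show "measure lebesgue k = Sup k - Inf k" if "k \<in> \<D>" for k
      using box[OF that] by auto
  qed simp
  finally show ?thesis
    by simp
qed

text \<open>A null set has an open cover U of measure below the \<eta> of absolute continuity, and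
  non-overlapping intervals inside U have total length at most the measure of U. In the next theorem
  U serves as the gauge at exceptional tags.\<close>

lemma abs_continuous_on_null_tags:
  assumes ac: "abs_continuous_interval a b f" and N: "negligible N" and "e > 0"
  shows "\<exists>U. open U \<and> N \<subseteq> U \<and>
    (\<forall>p. p tagged_partial_division_of {a..b} \<and> (\<forall>(x,K)\<in>p. K \<subseteq> U) \<longrightarrow>
       (\<Sum>(x,K)\<in>p. \<bar>f (Sup K) - f (Inf K)\<bar>) < e)"
proof -
  obtain \<eta> where "\<eta> > 0" and \<eta>:
    "\<And>\<D> S. \<lbrakk>\<D> division_of S; S \<subseteq> {a..b}; (\<Sum>k\<in>\<D>. Sup k - Inf k) < \<eta>\<rbrakk> \<Longrightarrow>
        (\<Sum>k\<in>\<D>. \<bar>f (Sup k) - f (Inf k)\<bar>) < e"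
    using ac \<open>e > 0\<close> unfolding abs_continuous_interval_def by meson
  have Nn: "N \<in> null_sets lebesgue"
    using N by (simp add: negligible_iff_null_sets)
  then obtain U where U: "open U" "N \<subseteq> U" "U - N \<in> lmeasurable" "emeasure lebesgue (U - N) < ennreal \<eta>"
    using sets_lebesgue_outer_open \<open>\<eta> > 0\<close> by (metis null_setsD2)
  have Um: "U \<in> lmeasurable"
    using U Nn by (metis borel_open measurable_Diff_null_set sets_completionI_sets sets_lborel)
  have "emeasure lebesgue U < ennreal \<eta>"
    using U Nn by (metis emeasure_Diff_null_set Um fmeasurableD)
  then have mU: "measure lebesgue U < \<eta>"
    using Um by (simp add: emeasure_eq_measure2 ennreal_less_iff)
  have "(\<Sum>(x,K)\<in>p. \<bar>f (Sup K) - f (Inf K)\<bar>) < e"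
    if p: "p tagged_partial_division_of {a..b}" and sub: "\<forall>(x,K)\<in>p. K \<subseteq> U" for p
  proof -
    \<comment> \<open>Passing from tagged pairs to bare intervals requires a summand that vanishes
      on degenerate intervals. The empty one needs a default, since \<open>Sup\<close> and
      \<open>Inf\<close> are unspecified there.\<close>
    define g where "g K = (if K = {} then 0 else \<bar>f (Sup K) - f (Inf K)\<bar>)" for K
    let ?S = "\<Union>(snd ` p)"
    have div: "snd ` p division_of ?S"
      using p by (rule partial_division_of_tagged_division)
    have "(\<Sum>(x,K)\<in>p. \<bar>f (Sup K) - f (Inf K)\<bar>) = (\<Sum>(x,K)\<in>p. g K)"
      by (rule sum.cong) (use p in \<open>auto simp: g_def dest: tagged_partial_division_ofD(2)\<close>)
    also have "\<dots> = (\<Sum>K\<in>snd ` p. g K)"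
    proof (rule sum.over_tagged_division_lemma[OF tagged_partial_division_of_Union_self[OF p]])
      fix u v :: real assume "box u v = {}"
      then show "g (cbox u v) = 0"
        by (cases "u = v") (auto simp: g_def)
    qed
    also have "\<dots> = (\<Sum>K\<in>snd ` p. \<bar>f (Sup K) - f (Inf K)\<bar>)"
      by (rule sum.cong) (use div in \<open>auto simp: g_def\<close>)
    also have "\<dots> < e"
    proof (rule \<eta>[OF div])
      show "?S \<subseteq> {a..b}"
        using tagged_partial_division_ofD(3)[OF p] by fastforce
      have "measure lebesgue ?S \<le> measure lebesgue U"
      proof (rule measure_mono_fmeasurable)
        show "?S \<subseteq> U"
          using sub by fastforce
        show "?S \<in> sets lebesgue"
          using lmeasurable_division[OF div] by (rule fmeasurableD)
      qed (rule Um)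
      then show "(\<Sum>K\<in>snd ` p. Sup K - Inf K) < \<eta>"
        using division_sum_length[OF div] mU by simp
    qed
    finally show ?thesis .
  qed
  with U(1,2) show ?thesis
    by blast
qed

text \<open>The gauge integral makes integrability of \<open>g\<close> part of the conclusion. At
  tags outside N the gauge is a ball on which the derivative approximates well; at tags in N it is
  the open set of the preceding lemma, so the increments of f there are negligible in total.\<close>

theorem fundamental_theorem_of_calculus_abs_continuous:
  fixes f g :: "real \<Rightarrow> real"
  assumes "a \<le> b" and ac: "abs_continuous_interval a b f" and N: "negligible N"
    and der: "\<And>x. x \<in> {a..b} - N \<Longrightarrow> (f has_vector_derivative g x) (at x within {a..b})"
  shows "(g has_integral (f b - f a)) {a..b}"
proof -
  \<comment> \<open>With value 0 on N, exceptional tags add nothing to the Riemann sum, and their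
    error is just the increment of f. Changing \<open>h\<close> back to \<open>g\<close> on a
    negligible set is harmless.\<close>
  define h where "h x = (if x \<in> N then 0 else g x)" for x
  have "(h has_integral (f b - f a)) {a..b}"
    unfolding has_integral_real
  proof (intro allI impI)
    fix e :: real assume "e > 0"
    \<comment> \<open>Chosen so that e1 * (b - a) is at most e / 2; the \<open>+ 1\<close> covers
      the case a = b.\<close>
    define e1 where "e1 = e / (2 * (b - a + 1))"
    have "e1 > 0"
      using \<open>e > 0\<close> \<open>a \<le> b\<close> by (simp add: e1_def)
    obtain U where U: "open U" "N \<subseteq> U" and Usum:
      "\<forall>p. p tagged_partial_division_of {a..b} \<and> (\<forall>(x,K)\<in>p. K \<subseteq> U) \<longrightarrow>
         (\<Sum>(x,K)\<in>p. \<bar>f (Sup K) - f (Inf K)\<bar>) < e / 2"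
      using abs_continuous_on_null_tags[OF ac N half_gt_zero[OF \<open>0 < e\<close>]] by blast
    have "\<forall>x. \<exists>d>0. x \<in> {a..b} - N \<longrightarrow>
         (\<forall>y\<in>{a..b}. norm (y-x) < d \<longrightarrow> norm (f y - f x - (y-x) *\<^sub>R g x) \<le> e1 * norm (y-x))"
      using der[unfolded has_vector_derivative_def has_derivative_within_alt] \<open>e1 > 0\<close> by blast
    then obtain d where d: "\<And>x. 0 < d x"
      "\<And>x y. \<lbrakk>x \<in> {a..b} - N; y \<in> {a..b}; norm (y-x) < d x\<rbrakk>
           \<Longrightarrow> norm (f y - f x - (y-x) *\<^sub>R g x) \<le> e1 * norm (y-x)"
      by metis
    define \<gamma> where "\<gamma> x = (if x \<in> N then U else ball x (d x))" for x
    have "gauge \<gamma>"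
      using U d(1) by (auto simp: gauge_def \<gamma>_def)
    moreover have "norm ((\<Sum>(x,K)\<in>p. measure lborel K *\<^sub>R h x) - (f b - f a)) < e"
      if p: "p tagged_division_of {a..b}" and fine: "\<gamma> fine p" for p
    proof -
      define q where "q = {(x,K) \<in> p. x \<in> N}"
      have "finite p" "q \<subseteq> p"
        using p by (auto simp: q_def)
      have ppart: "p tagged_partial_division_of {a..b}"
        using p by (simp add: tagged_division_of_def)
      have fsum: "f b - f a = (\<Sum>(x,K)\<in>p. f (Sup K) - f (Inf K))"
        using additive_tagged_division_1[OF \<open>a \<le> b\<close> p, of f] by simp
      have len: "b - a = (\<Sum>(x,K)\<in>p. Sup K - Inf K)"
        using additive_tagged_division_1[OF \<open>a \<le> b\<close> p, of "\<lambda>x. x"] by simp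
      have tag: "x \<in> K \<and> K \<subseteq> {a..b} \<and> (\<exists>c d. c \<le> d \<and> K = {c..d} \<and> x \<in> {c..d} \<and> c \<in> {a..b} \<and> d \<in> {a..b})" if "(x, K) \<in> p" for x K
      proof -
        obtain c d where "K = cbox c d"
          using p \<open>(x,K) \<in> p\<close> by blast
        moreover have "x \<in> K" "K \<subseteq> {a..b}"
          using p \<open>(x,K) \<in> p\<close> by blast+
        ultimately show ?thesis by auto
      qed
      have bnd: "norm (measure lborel K *\<^sub>R h x - (f (Sup K) - f (Inf K)))
         \<le> (if x \<in> N then \<bar>f (Sup K) - f (Inf K)\<bar> else 0) + e1 * (Sup K - Inf K)"
        if xK: "(x, K) \<in> p" for x K
      proof -
        obtain r s where K: "r \<le> s" "K = {r..s}" "x \<in> {r..s}" "r \<in> {a..b}" "s \<in> {a..b}"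
          using tag[OF xK] by blast
        show ?thesis
        proof (cases "x \<in> N")
          case True
          then show ?thesis
            using K \<open>e1 > 0\<close> by (simp add: h_def abs_minus_commute[of "f r"])
        next
          case False
          have "K \<subseteq> ball x (d x)"
            using fineD[OF fine xK] False by (simp add: \<gamma>_def)
          then have "norm (r - x) < d x" "norm (s - x) < d x"
            using K(1,2) by (auto simp: dist_real_def subset_iff abs_minus_commute)
          moreover have "x \<in> {a..b} - N"
            using K False by auto
          ultimately have "\<bar>f r - f x - (r - x) * g x\<bar> \<le> e1 * \<bar>r - x\<bar>"
             "\<bar>f s - f x - (s - x) * g x\<bar> \<le> e1 * \<bar>s - x\<bar>"
            using d(2)[of x r] d(2)[of x s] K(4,5) by simp_all
          \<comment> \<open>Straddling: the linear approximations from the tag to both endpoints are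
            subtracted. As the tag lies between them, the two distances add up to the length of the
            interval.\<close>
          moreover have "(s - r) * g x - (f s - f r) = (f r - f x - (r - x) * g x) - (f s - f x - (s - x) * g x)"
            by (simp add: algebra_simps)
          ultimately have "\<bar>(s - r) * g x - (f s - f r)\<bar> \<le> e1 * \<bar>r - x\<bar> + e1 * \<bar>s - x\<bar>"
            by linarith
          also have "\<dots> = e1 * (s - r)"
            using K(3) by (simp add: algebra_simps)
          finally show ?thesis
            using K(1,2) False by (simp add: h_def)
        qed
      qed
      have "norm ((\<Sum>(x,K)\<in>p. measure lborel K *\<^sub>R h x) - (f b - f a))
          = norm (\<Sum>(x,K)\<in>p. measure lborel K *\<^sub>R h x - (f (Sup K) - f (Inf K)))"
        by (simp add: fsum split_def sum_subtractf)
      also have "\<dots> \<le> (\<Sum>(x,K)\<in>p. (if x \<in> N then \<bar>f (Sup K) - f (Inf K)\<bar> else 0) + e1 * (Sup K - Inf K))"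
        by (rule sum_norm_le) (use bnd in auto)
      also have "\<dots> = (\<Sum>(x,K)\<in>p. if x \<in> N then \<bar>f (Sup K) - f (Inf K)\<bar> else 0) + e1 * (b - a)"
        by (simp add: len split_def sum.distrib sum_distrib_left)
      also have "(\<Sum>(x,K)\<in>p. if x \<in> N then \<bar>f (Sup K) - f (Inf K)\<bar> else 0) = (\<Sum>(x,K)\<in>q. \<bar>f (Sup K) - f (Inf K)\<bar>)"
        using \<open>finite p\<close> by (intro sum.mono_neutral_cong_right) (auto simp: q_def split: if_splits)
      also have "\<dots> < e / 2"
      proof (rule Usum[rule_format, OF conjI])
        show "q tagged_partial_division_of {a..b}"
          using ppart \<open>q \<subseteq> p\<close> by (rule tagged_partial_division_subset)
        show "\<forall>(x,K)\<in>q. K \<subseteq> U"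
        proof clarify
          fix x K y assume "(x, K) \<in> q" "y \<in> K"
          then show "y \<in> U"
            using fineD[OF fine, of x K] by (auto simp: q_def \<gamma>_def)
        qed
      qed
      also have "e1 * (b - a) \<le> e / 2"
        using \<open>e > 0\<close> \<open>a \<le> b\<close> by (simp add: e1_def field_simps)
      finally show ?thesis by simp
    qed
    ultimately show "\<exists>\<gamma>. gauge \<gamma> \<and> (\<forall>p. p tagged_division_of {a..b} \<and> \<gamma> fine p \<longrightarrow>
        norm ((\<Sum>(x,K)\<in>p. measure lborel K *\<^sub>R h x) - (f b - f a)) < e)"
      by (intro exI[of _ \<gamma>] conjI allI impI) simp_all
  qed
  then show ?thesis
    by (rule has_integral_spike[OF N, rotated]) (simp add: h_def)
qed

section \<open>Energy of damped oscillations\<close>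

lemma hderiv_works:
  assumes "f differentiable (at t within {0..})"
  shows "(f has_real_derivative hderiv f t) (at t within {0..})"
  using assms unfolding hderiv_def has_real_derivative_iff_has_vector_derivative
  by (simp add: vector_derivative_works)

lemma hderiv_eqI:
  assumes "t \<ge> 0" "(f has_real_derivative D) (at t within {0..})"
  shows "hderiv f t = D"
proof -
  have "at t within {0..} \<noteq> bot"
    unfolding trivial_limit_within islimpt_approachable_real not_not
  proof (intro allI impI)
    fix e :: real assume "e > 0"
    then show "\<exists>x\<in>{0..}. x \<noteq> t \<and> \<bar>x - t\<bar> < e"
      using assms(1) by (intro bexI[of _ "t + e / 2"]) auto
  qed
  then show ?thesis
    using assms(2) unfolding hderiv_def has_real_derivative_iff_has_vector_derivative
    by (rule vector_derivative_within)
qed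

lemma hderiv_works_interior:
  assumes "f differentiable_on {0..}" "t > 0"
  shows "(f has_real_derivative hderiv f t) (at t)"
proof -
  have "at t within {0..} = at t"
    using \<open>t > 0\<close> by (intro at_within_interior) simp
  moreover have "f differentiable (at t within {0..})"
    using assms by (simp add: differentiable_on_def)
  ultimately show ?thesis
    using hderiv_works by metis
qed

text \<open>The equations are required only inside the interval, and \<open>d\<close> need not agree with the damping at
  the endpoints. In this form the notion applies to both kinds of solutions.\<close>

definition oscillation ::
    "real \<Rightarrow> (real \<Rightarrow> real) \<Rightarrow> real \<Rightarrow> real \<Rightarrow> (real \<Rightarrow> real) \<Rightarrow> (real \<Rightarrow> real) \<Rightarrow> bool" where
  "oscillation lam d a b u v \<longleftrightarrow>
     continuous_on {a..b} u \<and> continuous_on {a..b} v \<and>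
     (\<forall>t\<in>{a<..<b}. (u has_real_derivative v t) (at t) \<and>
        (v has_real_derivative - 2 * d t * v t - lam\<^sup>2 * u t) (at t))"

lemma oscillation_subset:
  assumes "oscillation lam d a b u v" "a \<le> a'" "b' \<le> b"
  shows "oscillation lam d a' b' u v"
  using assms unfolding oscillation_def by (auto intro: continuous_on_subset)

text \<open>In the almost-everywhere case u' equals its initial value plus the integral of -2 d u' -
  lam^2 u. This integrand is continuous, so u' is differentiable at every interior time, not just at
  almost every one. In the classical case the equation is already pointwise.\<close>

lemma damped_solution_imp_oscillation:
  assumes sol: "damped_solution lam \<delta> u" and "0 \<le> a" "a \<le> b"
    and contd: "continuous_on {a..b} d" and eq: "\<And>t. t \<in> {a<..<b} \<Longrightarrow> \<delta> t = d t"
  shows "oscillation lam d a b u (hderiv u)"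
proof -
  let ?v = "hderiv u"
  have sub: "{a..b} \<subseteq> {0..}"
    using \<open>0 \<le> a\<close> by auto
  have diffu: "u differentiable_on {0..}"
    using sol by (auto simp: damped_solution_def classical_solution_def ae_solution_def split: if_splits)
  have contu: "continuous_on {a..b} u"
    using differentiable_imp_continuous_on[OF diffu] sub by (rule continuous_on_subset)
  have "continuous_on {0..} ?v"
    using sol by (auto simp: damped_solution_def classical_solution_def ae_solution_def
        intro: differentiable_imp_continuous_on split: if_splits)
  then have contv: "continuous_on {a..b} ?v"
    using sub by (rule continuous_on_subset)
  have deru: "(u has_real_derivative ?v t) (at t)" if "t \<in> {a<..<b}" for t
    using diffu that \<open>0 \<le> a\<close> by (intro hderiv_works_interior) auto
  have derv: "(?v has_real_derivative - 2 * d t * ?v t - lam\<^sup>2 * u t) (at t)" if t: "t \<in> {a<..<b}" for t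
  proof (cases "continuous_on {0..} \<delta>")
    case True
    then have cl: "?v differentiable_on {0..}" "hderiv ?v t + 2 * \<delta> t * ?v t + lam\<^sup>2 * u t = 0"
      using sol t \<open>0 \<le> a\<close> by (auto simp: damped_solution_def classical_solution_def)
    have "(?v has_real_derivative hderiv ?v t) (at t)"
      using cl(1) t \<open>0 \<le> a\<close> by (intro hderiv_works_interior) auto
    moreover have "hderiv ?v t = - 2 * d t * ?v t - lam\<^sup>2 * u t"
      using cl(2) eq[OF t] by simp
    ultimately show ?thesis by simp
  next
    case False
    define g where "g t = - 2 * d t * ?v t - lam\<^sup>2 * u t" for t
    have ae: "ae_solution lam \<delta> u"
      using sol False by (simp add: damped_solution_def)
    have contg: "continuous_on {a..b} g"
      unfolding g_def by (intro continuous_intros contd contu contv)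
    have "AE s in lebesgue. 0 \<le> s \<longrightarrow> ?v differentiable (at s within {0..}) \<and>
        hderiv ?v s + 2 * \<delta> s * ?v s + lam\<^sup>2 * u s = 0"
      using ae by (simp add: ae_solution_def)
    then obtain M where M: "M \<in> null_sets lebesgue"
      and Mout: "\<And>s. s \<notin> M \<Longrightarrow> 0 \<le> s \<Longrightarrow> ?v differentiable (at s within {0..}) \<and>
        hderiv ?v s + 2 * \<delta> s * ?v s + lam\<^sup>2 * u s = 0"
      by (elim AE_E3) auto
    \<comment> \<open>The endpoints join the exceptional set because the damping is known to equal
      \<open>d\<close> only in the open interval.\<close>
    have neg: "negligible (M \<union> {a, b})"
      using M by (simp add: negligible_iff_null_sets negligible_Un)
    have gint: "(g has_integral (?v y - ?v x)) {x..y}" if "a \<le> x" "x \<le> y" "y \<le> b" for x y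
    proof (rule fundamental_theorem_of_calculus_abs_continuous[OF that(2) _ neg])
      show "abs_continuous_interval x y ?v"
        using ae that \<open>0 \<le> a\<close> by (auto simp: ae_solution_def locally_abs_continuous_halfline_def)
      fix s assume s: "s \<in> {x..y} - (M \<union> {a, b})"
      then have s': "s \<in> {a<..<b}" "s \<notin> M" "0 \<le> s"
        using that \<open>0 \<le> a\<close> by auto
      have "hderiv ?v s = g s"
        using Mout[OF s'(2,3)] eq[OF s'(1)] by (simp add: g_def)
      then have "(?v has_vector_derivative g s) (at s within {0..})"
        using hderiv_works[of ?v s] Mout[OF s'(2,3)]
        by (simp add: has_real_derivative_iff_has_vector_derivative)
      then show "(?v has_vector_derivative g s) (at s within {x..y})"
        by (rule has_vector_derivative_within_subset) (use that \<open>0 \<le> a\<close> in auto)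
    qed
    have "((\<lambda>x. integral {a..x} g) has_real_derivative g t) (at t within {a..b})"
      using contg t by (intro integral_has_real_derivative) auto
    then have "((\<lambda>x. integral {a..x} g) has_real_derivative g t) (at t)"
      using t by (simp add: at_within_Icc_at)
    then have "((\<lambda>x. ?v a + integral {a..x} g) has_real_derivative g t) (at t)"
      by (auto intro: derivative_eq_intros)
    moreover have "\<forall>\<^sub>F x in nhds t. x \<in> {a<..<b}"
      using t by (intro eventually_nhds_in_open) auto
    then have "\<forall>\<^sub>F x in nhds t. ?v a + integral {a..x} g = ?v x"
      by eventually_elim (use integral_unique[OF gint] in auto)
    ultimately show ?thesis
      unfolding g_def using DERIV_cong_ev by fastforce
  qed
  show ?thesis
    unfolding oscillation_def using contu contv deru derv by blast
qed

section \<open>Energy and phase estimates for oscillations\<close>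

definition energy :: "real \<Rightarrow> (real \<Rightarrow> real) \<Rightarrow> (real \<Rightarrow> real) \<Rightarrow> real \<Rightarrow> real" where
  "energy lam u v t = (v t)\<^sup>2 + lam\<^sup>2 * (u t)\<^sup>2"

lemma energy_nonneg: "energy lam u v t \<ge> 0"
  by (simp add: energy_def)

lemma velocity_le_energy: "\<bar>v t\<bar> \<le> sqrt (energy lam u v t)"
  by (rule real_le_rsqrt) (simp add: energy_def)

lemma position_le_energy: "\<bar>lam * u t\<bar> \<le> sqrt (energy lam u v t)"
  by (rule real_le_rsqrt) (simp add: energy_def power_mult_distrib)

text \<open>In the derivative of the energy the terms with u v cancel, which leaves -4 d
  v^2.\<close>

lemma oscillation_energy_antimono:
  assumes osc: "oscillation lam d a b u v" and "a \<le> b" and d: "\<And>t. t \<in> {a<..<b} \<Longrightarrow> d t \<ge> 0"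
  shows "energy lam u v b \<le> energy lam u v a"
proof (rule DERIV_nonpos_imp_decreasing_open[OF \<open>a \<le> b\<close>])
  show "continuous_on {a..b} (energy lam u v)"
    using osc unfolding oscillation_def energy_def by (intro continuous_intros) auto
  fix t assume t: "a < t" "t < b"
  then have [derivative_intros]: "(u has_real_derivative v t) (at t)"
      "(v has_real_derivative - 2 * d t * v t - lam\<^sup>2 * u t) (at t)"
    using osc by (auto simp: oscillation_def)
  have "(energy lam u v has_real_derivative - 4 * d t * (v t)\<^sup>2) (at t)"
    unfolding energy_def by (auto intro!: derivative_eq_intros simp: algebra_simps power2_eq_square)
  then show "\<exists>y. (energy lam u v has_real_derivative y) (at t) \<and> y \<le> 0"
    using d[of t] t by (intro exI conjI) (auto simp: mult_nonpos_nonneg)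
qed

lemma oscillation_energy_le:
  assumes osc: "oscillation lam d a b u v" and d: "\<And>t. t \<in> {a<..<b} \<Longrightarrow> d t \<ge> 0"
    and "t \<in> {a..b}"
  shows "energy lam u v t \<le> energy lam u v a"
  by (rule oscillation_energy_antimono[OF oscillation_subset[OF osc]]) (use assms in auto)

text \<open>The speed never exceeds the root of the initial energy. The bound does not involve
  \<open>d\<close>, so a short burst hardly moves the position, however strong it is.\<close>

lemma oscillation_displacement:
  assumes osc: "oscillation lam d a b u v" and "a < b" and d: "\<And>t. t \<in> {a<..<b} \<Longrightarrow> d t \<ge> 0"
  shows "\<bar>u b - u a\<bar> \<le> (b - a) * sqrt (energy lam u v a)"
proof -
  let ?S = "sqrt (energy lam u v a)"
  have "\<bar>u b - u a\<bar> \<le> ?S * b - ?S * a"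
    unfolding real_norm_def[symmetric]
  proof (rule differentiable_bound_general[where \<phi> = "(*) ?S", OF \<open>a < b\<close>])
    show "continuous_on {a..b} u"
      using osc by (simp add: oscillation_def)
    fix t assume t: "a < t" "t < b"
    show "(u has_vector_derivative v t) (at t)"
      using osc t by (simp add: oscillation_def has_real_derivative_iff_has_vector_derivative)
    show "((*) ?S has_vector_derivative ?S) (at t)"
      by (auto intro!: derivative_eq_intros)
    have "\<bar>v t\<bar> \<le> sqrt (energy lam u v t)"
      by (rule velocity_le_energy)
    also have "\<dots> \<le> ?S"
      using oscillation_energy_le[OF osc d, of t] t by simp
    finally show "norm (v t) \<le> ?S" by simp
  qed (intro continuous_intros)
  then show ?thesis by (simp add: algebra_simps)
qed

text \<open>The integrating factor exp (2 D), with D the integral of d, gives (v exp (2 D))' =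
  -lam^2 u exp (2 D), and lam |u| stays below the root of the initial energy. The exponential term
  is what remains of the initial velocity; the term lam * (b - a) bounds what the restoring force
  creates meanwhile.\<close>

lemma oscillation_velocity:
  assumes osc: "oscillation lam d a b u v" and "a < b" and "lam > 0"
    and contd: "continuous_on {a..b} d" and d: "\<And>t. t \<in> {a<..<b} \<Longrightarrow> d t \<ge> 0"
  shows "\<bar>v b\<bar> \<le> (exp (- 2 * integral {a..b} d) + lam * (b - a)) * sqrt (energy lam u v a)"
proof -
  let ?S = "sqrt (energy lam u v a)"
  define D where "D t = integral {a..t} d" for t
  have derD: "(D has_real_derivative d t) (at t within {a..b})" if "t \<in> {a..b}" for t
    unfolding D_def using contd that by (rule integral_has_real_derivative)
  have contD: "continuous_on {a..b} D"
    using derD by (rule DERIV_continuous_on)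
  have derD': "(D has_real_derivative d t) (at t)" if "a < t" "t < b" for t
    using derD[of t] that by (simp add: at_within_Icc_at)
  have Dmono: "D t \<le> D b" if "t \<in> {a..b}" for t
  proof (rule DERIV_nonneg_imp_increasing_open[of t b D])
    show "continuous_on {t..b} D"
      using contD that by (auto intro: continuous_on_subset)
    show "\<exists>y. (D has_real_derivative y) (at s) \<and> 0 \<le> y" if "t < s" "s < b" for s
      using derD'[of s] d[of s] that \<open>t \<in> {a..b}\<close> by auto
  qed (use that in auto)
  define w where "w t = v t * exp (2 * D t)" for t
  let ?C = "lam * ?S * exp (2 * D b)"
  have "\<bar>w b - w a\<bar> \<le> ?C * b - ?C * a"
    unfolding real_norm_def[symmetric]
  proof (rule differentiable_bound_general[where \<phi> = "(*) ?C", OF \<open>a < b\<close>])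
    show "continuous_on {a..b} w"
      unfolding w_def using osc contD by (intro continuous_intros) (auto simp: oscillation_def)
    fix t assume t: "a < t" "t < b"
    have [derivative_intros]: "(v has_real_derivative - 2 * d t * v t - lam\<^sup>2 * u t) (at t)"
      using osc t by (simp add: oscillation_def)
    note [derivative_intros] = derD'[OF t]
    have "(w has_real_derivative - lam * (lam * u t) * exp (2 * D t)) (at t)"
      unfolding w_def by (auto intro!: derivative_eq_intros simp: algebra_simps power2_eq_square)
    then show "(w has_vector_derivative - lam * (lam * u t) * exp (2 * D t)) (at t)"
      by (simp add: has_real_derivative_iff_has_vector_derivative)
    show "((*) ?C has_vector_derivative ?C) (at t)"
      by (auto intro!: derivative_eq_intros)
    have "\<bar>lam * u t\<bar> \<le> sqrt (energy lam u v t)"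
      by (rule position_le_energy)
    also have "\<dots> \<le> ?S"
      using oscillation_energy_le[OF osc d, of t] t by simp
    finally have "lam * \<bar>lam * u t\<bar> * exp (2 * D t) \<le> lam * ?S * exp (2 * D b)"
      using \<open>lam > 0\<close> Dmono[of t] t by (intro mult_mono) (auto simp: energy_nonneg)
    then show "norm (- lam * (lam * u t) * exp (2 * D t)) \<le> ?C"
      using \<open>lam > 0\<close> by (simp add: abs_mult)
  qed (intro continuous_intros)
  moreover have "w a = v a"
    by (simp add: w_def D_def)
  ultimately have "\<bar>w b\<bar> \<le> \<bar>v a\<bar> + ?C * (b - a)"
    by (simp add: algebra_simps)
  also have "\<dots> \<le> ?S + ?C * (b - a)"
    using velocity_le_energy[of v a lam u] by simp
  finally have "\<bar>w b\<bar> \<le> ?S + ?C * (b - a)" .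
  then have "exp (- 2 * D b) * \<bar>w b\<bar> \<le> exp (- 2 * D b) * (?S + ?C * (b - a))"
    by (rule mult_left_mono) simp
  moreover have "exp (- 2 * D b) * exp (2 * D b) = 1"
    by (simp flip: exp_add)
  ultimately show ?thesis
    unfolding w_def D_def[symmetric] by (simp add: algebra_simps abs_mult exp_minus)
qed

text \<open>Undamped motion is a rotation of the phase point (lam u, v). Only the position is
  followed: whatever the velocity has become, the second burst takes care of it.\<close>

lemma oscillation_free:
  assumes osc: "oscillation lam (\<lambda>_. 0) a b u v" and "a < b"
  shows "lam * u b = lam * u a * cos (lam * (b - a)) + v a * sin (lam * (b - a))"
proof -
  \<comment> \<open>The \<open>lam * u\<close> coordinate of the phase point, rotated up to time \<open>b\<close>.\<close>
  define w where "w t = lam * u t * cos (lam * (b - t)) + v t * sin (lam * (b - t))" for t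
  have "w b = w a"
  proof (rule DERIV_isconst_end[OF \<open>a < b\<close>])
    show "continuous_on {a..b} w"
      unfolding w_def using osc by (intro continuous_intros) (auto simp: oscillation_def)
    fix t assume t: "a < t" "t < b"
    have [derivative_intros]: "(u has_real_derivative v t) (at t)"
      "(v has_real_derivative - lam\<^sup>2 * u t) (at t)"
      using osc t by (auto simp: oscillation_def)
    show "(w has_real_derivative 0) (at t)"
      unfolding w_def by (auto intro!: derivative_eq_intros simp: algebra_simps power2_eq_square)
  qed
  then show ?thesis
    by (simp add: w_def)
qed

section \<open>Bursts of damping\<close>

text \<open>The continuous representative \<open>d\<close> absorbs jumps of the damping at the
  endpoints, such as those of the piecewise constant profile, so that the estimates above apply on
  the closed interval.\<close>

definition burst :: "(real \<Rightarrow> real) \<Rightarrow> real \<Rightarrow> real \<Rightarrow> real \<Rightarrow> bool" where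
  "burst \<delta> a b I \<longleftrightarrow>
     (\<exists>d. continuous_on {a..b} d \<and> (\<forall>t\<in>{a<..<b}. \<delta> t = d t \<and> d t \<ge> 0) \<and> integral {a..b} d \<ge> I)"

lemma damped_solution_burst:
  assumes sol: "damped_solution lam \<delta> u" and "lam > 0" "0 \<le> a" "a < b" and burst: "burst \<delta> a b I"
  shows "t \<in> {a..b} \<Longrightarrow> energy lam u (hderiv u) t \<le> energy lam u (hderiv u) a"
    and "\<bar>u b - u a\<bar> \<le> (b - a) * sqrt (energy lam u (hderiv u) a)"
    and "\<bar>hderiv u b\<bar> \<le> (exp (- 2 * I) + lam * (b - a)) * sqrt (energy lam u (hderiv u) a)"
proof -
  obtain d where d: "continuous_on {a..b} d" "\<And>t. t \<in> {a<..<b} \<Longrightarrow> \<delta> t = d t"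
      "\<And>t. t \<in> {a<..<b} \<Longrightarrow> d t \<ge> 0" and I: "I \<le> integral {a..b} d"
    using burst unfolding burst_def by blast
  have osc: "oscillation lam d a b u (hderiv u)"
    using damped_solution_imp_oscillation[OF sol \<open>0 \<le> a\<close> _ d(1,2)] \<open>a < b\<close> by simp
  show "t \<in> {a..b} \<Longrightarrow> energy lam u (hderiv u) t \<le> energy lam u (hderiv u) a"
    using oscillation_energy_le[OF osc d(3)] by simp
  show "\<bar>u b - u a\<bar> \<le> (b - a) * sqrt (energy lam u (hderiv u) a)"
    by (rule oscillation_displacement[OF osc \<open>a < b\<close> d(3)])
  have "\<bar>hderiv u b\<bar> \<le> (exp (- 2 * integral {a..b} d) + lam * (b - a)) * sqrt (energy lam u (hderiv u) a)"
    by (rule oscillation_velocity[OF osc \<open>a < b\<close> \<open>lam > 0\<close> d(1,3)])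
  also have "\<dots> \<le> (exp (- 2 * I) + lam * (b - a)) * sqrt (energy lam u (hderiv u) a)"
    using I by (intro mult_right_mono) (auto simp: energy_nonneg)
  finally show "\<bar>hderiv u b\<bar> \<le> (exp (- 2 * I) + lam * (b - a)) * sqrt (energy lam u (hderiv u) a)" .
qed

section \<open>Energy loss over one block and over all blocks\<close>

text \<open>The parameter s is the relative accuracy of the block:
  \<open>lam * \<tau> \<le> s\<close> limits drift and loss of rotation angle, and the burst
  integral 1 / (2 * s) limits the surviving velocity.\<close>

definition braking_block :: "real \<Rightarrow> (real \<Rightarrow> real) \<Rightarrow> real \<Rightarrow> real \<Rightarrow> real \<Rightarrow> real \<Rightarrow> bool" where
  "braking_block lam \<delta> a c \<tau> s \<longleftrightarrow>
     0 < s \<and> 0 < \<tau> \<and> lam * \<tau> \<le> s \<and> 2 * \<tau> < c - a \<and>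
     burst \<delta> a (a + \<tau>) (1 / (2 * s)) \<and> (\<forall>t\<in>{a + \<tau><..<c - \<tau>}. \<delta> t = 0) \<and>
     burst \<delta> (c - \<tau>) c (1 / (2 * s))"

text \<open>This explains the burst integral 1 / (2 * s): the surviving fraction exp (-1 / s) is at
  most s because 1 / s \<le> exp (1 / s).\<close>

lemma exp_neg_inverse_le:
  fixes s :: real
  assumes "s > 0"
  shows "exp (- 2 * (1 / (2 * s))) \<le> s"
proof -
  have "1 / s \<le> exp (1 / s)"
    using exp_ge_add_one_self[of "1 / s"] by linarith
  then have "exp (- (1 / s)) \<le> s"
    using assms by (simp add: exp_minus field_simps)
  then show ?thesis by simp
qed

text \<open>With S the root of the initial energy, the first burst leaves velocity at most 2 s S and
  lam |u| at most S. The rotation turns these into lam |u| at most 2 s S + 2 s S. The second burst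
  adds a drift of at most s S, giving 5 s S, and leaves velocity at most 2 s S. No smallness of s
  enters.\<close>

lemma braking_block_energy:
  assumes sol: "damped_solution lam \<delta> u" and "lam > 0" "0 \<le> a"
    and block: "braking_block lam \<delta> a c \<tau> s"
  shows braking_block_energy_le: "t \<in> {a..c} \<Longrightarrow> energy lam u (hderiv u) t \<le> energy lam u (hderiv u) a"
    and braking_block_energy_decay: "c - a = pi / (2 * lam) \<Longrightarrow>
      energy lam u (hderiv u) c \<le> 50 * s\<^sup>2 * energy lam u (hderiv u) a"
proof -
  let ?E = "energy lam u (hderiv u)" and ?v = "hderiv u"
  let ?p = "a + \<tau>" and ?q = "c - \<tau>"
  have s: "0 < s" "0 < \<tau>" "lam * \<tau> \<le> s" "2 * \<tau> < c - a"
    and b1: "burst \<delta> a ?p (1 / (2 * s))" and b2: "burst \<delta> ?q c (1 / (2 * s))"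
    and free: "\<And>t. t \<in> {?p<..<?q} \<Longrightarrow> \<delta> t = 0"
    using block by (auto simp: braking_block_def)
  note burst1 = damped_solution_burst[OF sol \<open>lam > 0\<close> \<open>0 \<le> a\<close> _ b1]
  note burst2 = damped_solution_burst[OF sol \<open>lam > 0\<close> _ _ b2]
  have osc: "oscillation lam (\<lambda>_. 0) ?p ?q u ?v"
    using s \<open>0 \<le> a\<close> free by (intro damped_solution_imp_oscillation[OF sol]) auto
  have E1: "?E t \<le> ?E a" if "t \<in> {a..?p}" for t
    using burst1(1) s that by simp
  have E2: "?E t \<le> ?E a" if "t \<in> {?p..?q}" for t
    using oscillation_energy_le[OF osc, of t] E1[of ?p] s that by auto
  have E3: "?E t \<le> ?E a" if "t \<in> {?q..c}" for t
    using burst2(1)[of t] E2[of ?q] s \<open>0 \<le> a\<close> that by auto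
  show "?E t \<le> ?E a" if "t \<in> {a..c}"
    using E1 E2 E3 that by (cases "t \<le> ?p"; cases "t \<le> ?q") auto
  show "?E c \<le> 50 * s\<^sup>2 * ?E a" if ca: "c - a = pi / (2 * lam)"
  proof -
    let ?S = "sqrt (?E a)"
    have S: "0 \<le> ?S"
      by (simp add: energy_nonneg)
    have "\<bar>?v ?p\<bar> \<le> (s + s) * ?S"
    proof -
      have "\<bar>?v ?p\<bar> \<le> (exp (- 2 * (1 / (2 * s))) + lam * (?p - a)) * ?S"
        by (rule burst1(3)) (use s in simp)
      also have "\<dots> \<le> (s + s) * ?S"
        using s(3) exp_neg_inverse_le[OF s(1)] by (intro mult_right_mono S add_mono) auto
      finally show ?thesis .
    qed
    then have vp: "\<bar>?v ?p\<bar> \<le> 2 * s * ?S"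
      by simp
    have up: "\<bar>lam * u ?p\<bar> \<le> ?S"
      using order_trans[OF position_le_energy[of lam u ?p ?v]] E1[of ?p] s by simp
    have ang: "lam * (?q - ?p) = pi / 2 - 2 * (lam * \<tau>)"
    proof -
      have "lam * (?q - ?p) = lam * (c - a) - 2 * (lam * \<tau>)"
        by (simp add: algebra_simps)
      then show ?thesis
        using \<open>lam > 0\<close> ca by simp
    qed
    have uq: "\<bar>lam * u ?q\<bar> \<le> 4 * s * ?S"
    proof -
      have "lam * u ?q = lam * u ?p * cos (lam * (?q - ?p)) + ?v ?p * sin (lam * (?q - ?p))"
        using oscillation_free[OF osc] s by simp
      \<comment> \<open>Here the block length of a quarter period enters: the rotation misses pi / 2
        only by the duration of the two bursts, so the old position contributes only the sine of a
        small angle.\<close>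
      also have "cos (lam * (?q - ?p)) = sin (2 * (lam * \<tau>))"
        unfolding ang by (simp add: sin_cos_eq)
      finally have "\<bar>lam * u ?q\<bar> \<le> \<bar>lam * u ?p * sin (2 * (lam * \<tau>))\<bar> + \<bar>?v ?p * sin (lam * (?q - ?p))\<bar>"
        by linarith
      also have "\<bar>lam * u ?p * sin (2 * (lam * \<tau>))\<bar> \<le> ?S * (2 * s)"
      proof -
        have "\<bar>sin (2 * (lam * \<tau>))\<bar> \<le> 2 * s"
          using abs_sin_le_one abs_sin_x_le_abs_x[of "2 * (lam * \<tau>)"] s \<open>lam > 0\<close> by auto
        then show ?thesis
          unfolding abs_mult[of "lam * u ?p"] using up S by (intro mult_mono) auto
      qed
      also have "\<bar>?v ?p * sin (lam * (?q - ?p))\<bar> \<le> 2 * s * ?S"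
        unfolding abs_mult using vp mult_left_le[of "\<bar>sin (lam * (?q - ?p))\<bar>" "\<bar>?v ?p\<bar>"] by simp
      finally show ?thesis by simp
    qed
    have Eq: "sqrt (?E ?q) \<le> ?S"
      using E2[of ?q] s by simp
    have vc: "\<bar>?v c\<bar> \<le> 5 * s * ?S"
    proof -
      have "\<bar>?v c\<bar> \<le> (exp (- 2 * (1 / (2 * s))) + lam * (c - ?q)) * sqrt (?E ?q)"
        by (rule burst2(3)) (use s \<open>0 \<le> a\<close> in auto)
      also have "\<dots> \<le> (s + s) * ?S"
        using s exp_neg_inverse_le[OF s(1)] Eq by (intro mult_mono add_mono) (auto simp: energy_nonneg)
      \<comment> \<open>Weakened to the constant needed for the position, so that \<open>sq\<close>
        treats both coordinates alike.\<close>
      also have "\<dots> \<le> 5 * s * ?S"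
        using s S by (intro mult_right_mono) auto
      finally show ?thesis .
    qed
    have uc: "\<bar>lam * u c\<bar> \<le> 5 * s * ?S"
    proof -
      have "\<bar>u c - u ?q\<bar> \<le> (c - ?q) * sqrt (?E ?q)"
        by (rule burst2(2)) (use s \<open>0 \<le> a\<close> in auto)
      then have "lam * \<bar>u c - u ?q\<bar> \<le> lam * \<tau> * sqrt (?E ?q)"
        using \<open>lam > 0\<close> by simp
      also have "\<dots> \<le> s * ?S"
        using s Eq by (intro mult_mono) (auto simp: energy_nonneg)
      finally have "\<bar>lam * u c - lam * u ?q\<bar> \<le> s * ?S"
        using \<open>lam > 0\<close> by (simp add: abs_mult flip: right_diff_distrib)
      then show ?thesis
        using uq by linarith
    qed
    have sq: "x\<^sup>2 \<le> 25 * s\<^sup>2 * ?E a" if "\<bar>x\<bar> \<le> 5 * s * ?S" for x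
      using power_mono[OF that, of 2] by (simp add: power_mult_distrib energy_nonneg)
    show ?thesis
      using sq[OF vc] sq[OF uc] by (simp add: energy_def[of lam u ?v c] power_mult_distrib)
  qed
qed

text \<open>A time t in block m = n + 1 profits from the reduction completed in block n. Since t
  \<le> (n + 2) * T, monotonicity of \<phi> turns the value at (n + 2) * T into the value at
  t.\<close>

lemma braking_blocks_imp_decay:
  assumes "lam > 0" and mono: "antimono_on {0..} \<phi>"
    and T: "T = pi / (2 * lam)"
    and block: "\<And>n. braking_block lam \<delta> (real n * T) (real (Suc n) * T) (\<tau> n) (s n)"
    and s: "\<And>n. 50 * (s n)\<^sup>2 \<le> \<phi> (real (n + 2) * T)"
  shows "decays_at_rate lam \<phi> T \<delta>"
  unfolding decays_at_rate_def
proof (intro allI impI)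
  fix u t assume sol: "damped_solution lam \<delta> u" and "T \<le> t"
  let ?E = "energy lam u (hderiv u)"
  have "T > 0"
    using \<open>lam > 0\<close> T by simp
  have nT: "0 \<le> real n * T" for n
    using \<open>T > 0\<close> by simp
  have E0: "?E (real n * T) \<le> ?E 0" for n
  proof (induction n)
    case (Suc n)
    then show ?case
      using braking_block_energy_le[OF sol \<open>lam > 0\<close> nT block, of "real (Suc n) * T" n] \<open>T > 0\<close>
      by (simp add: algebra_simps)
  qed simp
  \<comment> \<open>The index of the block containing t. From T \<le> t follows m \<ge> 1, so at
    least one block is complete.\<close>
  define m where "m = nat \<lfloor>t / T\<rfloor>"
  have "1 \<le> t / T"
    using \<open>T \<le> t\<close> \<open>T > 0\<close> by simp
  then have "1 \<le> \<lfloor>t / T\<rfloor>"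
    by simp
  then have rm: "real m = of_int \<lfloor>t / T\<rfloor>" and "m \<ge> 1"
    unfolding m_def by linarith+
  then have "real m \<le> t / T" "t / T < real m + 1"
    by linarith+
  then have mt: "real m * T \<le> t" "t \<le> real (Suc m) * T"
    using \<open>T > 0\<close> by (auto simp: field_simps)
  obtain n where n: "m = Suc n"
    using \<open>m \<ge> 1\<close> by (cases m) auto
  have "?E t \<le> ?E (real m * T)"
    using braking_block_energy_le[OF sol \<open>lam > 0\<close> nT block] mt by simp
  also have "\<dots> \<le> 50 * (s n)\<^sup>2 * ?E (real n * T)"
    unfolding n by (rule braking_block_energy_decay[OF sol \<open>lam > 0\<close> nT block])
      (simp add: T[symmetric] distrib_right)
  \<comment> \<open>Reductions from blocks before n are discarded; that the energy has not grown is
    enough.\<close>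
  also have "\<dots> \<le> \<phi> (real (n + 2) * T) * ?E 0"
    using s[of n] E0[of n] by (intro mult_mono) (auto simp: energy_nonneg intro: order_trans[rotated])
  also have "\<dots> \<le> \<phi> t * ?E 0"
  proof (intro mult_right_mono energy_nonneg)
    show "\<phi> (real (n + 2) * T) \<le> \<phi> t"
      using mono mt \<open>T \<le> t\<close> \<open>T > 0\<close> by (auto simp: n monotone_on_def)
  qed
  finally show "\<bar>hderiv u t\<bar>\<^sup>2 + lam\<^sup>2 * \<bar>u t\<bar>\<^sup>2 \<le> (\<bar>hderiv u 0\<bar>\<^sup>2 + lam\<^sup>2 * \<bar>u 0\<bar>\<^sup>2) * \<phi> t"
    by (simp add: energy_def mult.commute)
qed

section \<open>Assembling the damping from scaled bumps\<close>

text \<open>An interface shared by the smooth and the discontinuous profile. A positive integral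
  suffices, since the amplitude is free; \<open>d\<close> is again a continuous representative up to
  the endpoints.\<close>

definition bump_family :: "(real \<Rightarrow> real \<Rightarrow> real \<Rightarrow> real) \<Rightarrow> bool" where
  "bump_family B \<longleftrightarrow> (\<forall>a b. a < b \<longrightarrow>
     (\<forall>t. 0 \<le> B a b t) \<and> (\<forall>t. t \<notin> {a<..<b} \<longrightarrow> B a b t = 0) \<and>
     (\<exists>d. continuous_on {a..b} d \<and> (\<forall>t\<in>{a<..<b}. B a b t = d t) \<and> integral {a..b} d > 0))"

lemma bump_familyD:
  assumes "bump_family B" "a < b"
  shows "0 \<le> B a b t" "t \<notin> {a<..<b} \<Longrightarrow> B a b t = 0"
  using assms unfolding bump_family_def by blast+

lemma bump_family_burst:
  assumes B: "bump_family B" "a < b" and "I \<ge> 0"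
  shows "\<exists>K\<ge>0. burst (\<lambda>t. K * B a b t) a b I"
proof -
  obtain d where d: "continuous_on {a..b} d" "\<And>t. t \<in> {a<..<b} \<Longrightarrow> B a b t = d t"
      and J: "integral {a..b} d > 0"
    using B unfolding bump_family_def by blast
  define K where "K = I / integral {a..b} d"
  have "K \<ge> 0"
    using J \<open>I \<ge> 0\<close> by (simp add: K_def)
  moreover have "burst (\<lambda>t. K * B a b t) a b I"
    unfolding burst_def
  proof (intro exI conjI ballI)
    show "continuous_on {a..b} (\<lambda>t. K * d t)"
      by (intro continuous_intros d(1))
    show "K * B a b t = K * d t" "0 \<le> K * d t" if "t \<in> {a<..<b}" for t
      using d(2)[OF that] bump_familyD(1)[OF B, of t] \<open>K \<ge> 0\<close> by auto
    show "I \<le> integral {a..b} (\<lambda>t. K * d t)"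
      using J by (simp add: K_def)
  qed
  ultimately show ?thesis by blast
qed

lemma burst_cong:
  assumes "burst \<delta> a b I" "\<And>t. t \<in> {a<..<b} \<Longrightarrow> \<delta>' t = \<delta> t"
  shows "burst \<delta>' a b I"
  using assms unfolding burst_def by simp

definition block_damping ::
    "(real \<Rightarrow> real \<Rightarrow> real \<Rightarrow> real) \<Rightarrow> real \<Rightarrow> (nat \<Rightarrow> real) \<Rightarrow> (nat \<Rightarrow> real) \<Rightarrow> (nat \<Rightarrow> real) \<Rightarrow> nat \<Rightarrow> real \<Rightarrow> real"
  where
  "block_damping B T \<tau> K L n t =
     K n * B (real n * T) (real n * T + \<tau> n) t + L n * B (real (Suc n) * T - \<tau> n) (real (Suc n) * T) t"

text \<open>The floor selects the single block formula in force at t. For a bump family with bursts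
  short enough to fit, both neighbouring formulas vanish at a common endpoint, so the choice made
  there is immaterial.\<close>

definition pulsating_damping ::
    "(real \<Rightarrow> real \<Rightarrow> real \<Rightarrow> real) \<Rightarrow> real \<Rightarrow> (nat \<Rightarrow> real) \<Rightarrow> (nat \<Rightarrow> real) \<Rightarrow> (nat \<Rightarrow> real) \<Rightarrow> real \<Rightarrow> real"
  where "pulsating_damping B T \<tau> K L t = block_damping B T \<tau> K L (nat \<lfloor>t / T\<rfloor>) t"

lemma nat_floor_divide_eq:
  fixes T :: real
  assumes "T > 0" "real n * T \<le> t" "t < real (Suc n) * T"
  shows "nat \<lfloor>t / T\<rfloor> = n"
proof -
  have "real n \<le> t / T" "t / T < real n + 1"
    using assms by (auto simp: field_simps)
  then have "\<lfloor>t / T\<rfloor> = int n"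
    by linarith
  then show ?thesis by simp
qed

lemma block_damping_outside:
  assumes "bump_family B" "0 < \<tau> n" "2 * \<tau> n < T" "t \<notin> {real n * T<..<real (Suc n) * T}"
  shows "block_damping B T \<tau> K L n t = 0"
proof -
  have "B (real n * T) (real n * T + \<tau> n) t = 0" "B (real (Suc n) * T - \<tau> n) (real (Suc n) * T) t = 0"
    using assms by (auto intro!: bump_familyD(2)[OF assms(1)] simp: algebra_simps)
  then show ?thesis
    by (simp add: block_damping_def)
qed

lemma pulsating_damping_eq_block:
  assumes "T > 0" "real n * T \<le> t" "t < real (Suc n) * T"
  shows "pulsating_damping B T \<tau> K L t = block_damping B T \<tau> K L n t"
  unfolding pulsating_damping_def nat_floor_divide_eq[OF assms] ..

lemma pulsating_damping_nonneg:
  assumes "bump_family B" "\<And>n. 0 < \<tau> n" "\<And>n. 0 \<le> K n" "\<And>n. 0 \<le> L n"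
  shows "0 \<le> pulsating_damping B T \<tau> K L t"
proof -
  have "0 \<le> block_damping B T \<tau> K L n t" for n
    unfolding block_damping_def using assms
      bump_familyD(1)[OF assms(1), of "real n * T" "real n * T + \<tau> n" t]
      bump_familyD(1)[OF assms(1), of "real (Suc n) * T - \<tau> n" "real (Suc n) * T" t]
    by (intro add_nonneg_nonneg mult_nonneg_nonneg) auto
  then show ?thesis
    by (simp add: pulsating_damping_def)
qed

lemma pulsating_damping_decay:
  assumes B: "bump_family B" and "lam > 0" and pos: "\<And>t. t \<ge> 0 \<Longrightarrow> \<phi> t > 0"
    and mono: "antimono_on {0..} \<phi>" and T: "T = pi / (2 * lam)"
  shows "\<exists>\<tau> K L. (\<forall>n. 0 < \<tau> n \<and> 2 * \<tau> n < T \<and> 0 \<le> K n \<and> 0 \<le> L n) \<and>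
    decays_at_rate lam \<phi> T (pulsating_damping B T \<tau> K L)"
proof -
  have "T > 0"
    using \<open>lam > 0\<close> T by simp
  \<comment> \<open>Solves 50 * s^2 = \<phi> ((n + 2) * T); positivity of \<phi> makes s
    positive.\<close>
  define s where "s n = sqrt (\<phi> (real (n + 2) * T) / 50)" for n
  \<comment> \<open>The first entry gives lam * \<tau> \<le> s, the second leaves room for a free
    phase between the bursts.\<close>
  define \<tau> where "\<tau> n = min (s n / lam) (T / 3)" for n
  have phi: "\<phi> (real (n + 2) * T) > 0" for n
    using pos \<open>T > 0\<close> by simp
  have s: "0 < s n" "50 * (s n)\<^sup>2 \<le> \<phi> (real (n + 2) * T)" for n
    using phi[of n] by (auto simp: s_def)
  have \<tau>: "0 < \<tau> n" "2 * \<tau> n < T" "lam * \<tau> n \<le> s n" for n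
    using s(1)[of n] \<open>T > 0\<close> \<open>lam > 0\<close> by (auto simp: \<tau>_def min_def field_simps)
  have "\<forall>n. \<exists>K\<ge>0. burst (\<lambda>t. K * B (real n * T) (real n * T + \<tau> n) t) (real n * T) (real n * T + \<tau> n) (1 / (2 * s n))"
    using s(1) \<tau>(1) by (intro allI bump_family_burst[OF B]) (auto simp: less_imp_le)
  then obtain K where K: "\<And>n. K n \<ge> 0"
    "\<And>n. burst (\<lambda>t. K n * B (real n * T) (real n * T + \<tau> n) t) (real n * T) (real n * T + \<tau> n) (1 / (2 * s n))"
    by metis
  have "\<forall>n. \<exists>L\<ge>0. burst (\<lambda>t. L * B (real (Suc n) * T - \<tau> n) (real (Suc n) * T) t)
      (real (Suc n) * T - \<tau> n) (real (Suc n) * T) (1 / (2 * s n))"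
    using s(1) \<tau>(1) by (intro allI bump_family_burst[OF B]) (auto simp: less_imp_le)
  then obtain L where L: "\<And>n. L n \<ge> 0"
    "\<And>n. burst (\<lambda>t. L n * B (real (Suc n) * T - \<tau> n) (real (Suc n) * T) t)
      (real (Suc n) * T - \<tau> n) (real (Suc n) * T) (1 / (2 * s n))"
    by metis
  let ?\<delta> = "pulsating_damping B T \<tau> K L"
  have "braking_block lam ?\<delta> (real n * T) (real (Suc n) * T) (\<tau> n) (s n)" for n
    unfolding braking_block_def
  proof (intro conjI ballI s \<tau>)
    have len: "real n * T + \<tau> n < real (Suc n) * T - \<tau> n"
      using \<tau>(2)[of n] by (simp add: algebra_simps)
    then show "2 * \<tau> n < real (Suc n) * T - real n * T"
      by simp
    have eq: "?\<delta> t = block_damping B T \<tau> K L n t" if "t \<in> {real n * T<..<real (Suc n) * T}" for t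
      using pulsating_damping_eq_block[OF \<open>T > 0\<close>, of n t] that by auto
    have left0: "B (real n * T) (real n * T + \<tau> n) t = 0" if "real n * T + \<tau> n \<le> t" for t
      using that \<tau>(1) by (intro bump_familyD(2)[OF B]) auto
    have right0: "B (real (Suc n) * T - \<tau> n) (real (Suc n) * T) t = 0" if "t \<le> real (Suc n) * T - \<tau> n" for t
      using that \<tau>(1) by (intro bump_familyD(2)[OF B]) auto
    show "burst ?\<delta> (real n * T) (real n * T + \<tau> n) (1 / (2 * s n))"
    proof (rule burst_cong[OF K(2)])
      fix t assume "t \<in> {real n * T<..<real n * T + \<tau> n}"
      then show "?\<delta> t = K n * B (real n * T) (real n * T + \<tau> n) t"
        using eq[of t] right0[of t] len \<tau>(1)[of n] by (auto simp: block_damping_def)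
    qed
    show "burst ?\<delta> (real (Suc n) * T - \<tau> n) (real (Suc n) * T) (1 / (2 * s n))"
    proof (rule burst_cong[OF L(2)])
      fix t assume "t \<in> {real (Suc n) * T - \<tau> n<..<real (Suc n) * T}"
      then show "?\<delta> t = L n * B (real (Suc n) * T - \<tau> n) (real (Suc n) * T) t"
        using eq[of t] left0[of t] len \<tau>(1)[of n] by (auto simp: block_damping_def)
    qed
    fix t assume "t \<in> {real n * T + \<tau> n<..<real (Suc n) * T - \<tau> n}"
    then show "?\<delta> t = 0"
      using eq[of t] left0[of t] right0[of t] \<tau>(1)[of n] by (auto simp: block_damping_def)
  qed
  then have "decays_at_rate lam \<phi> T ?\<delta>"
    by (rule braking_blocks_imp_decay[OF \<open>lam > 0\<close> mono T _ s(2)])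
  then show ?thesis
    using \<tau> K(1) L(1) by blast
qed

section \<open>The piecewise constant damping\<close>

text \<open>The open interval makes the bump vanish at its endpoints, as a bump family must. This is
  why the left end of a block is a constancy interval of its own below.\<close>

definition box_bump :: "real \<Rightarrow> real \<Rightarrow> real \<Rightarrow> real" where
  "box_bump a b t = (if t \<in> {a<..<b} then 1 else 0)"

lemma bump_family_box: "bump_family box_bump"
  unfolding bump_family_def box_bump_def
  by (auto intro!: exI[of _ "\<lambda>_. 1"])

lemma block_damping_box_constant_on:
  assumes "0 < \<tau> n" "2 * \<tau> n < T"
  shows "block_damping box_bump T \<tau> K L n constant_on {real n * T}"
    and "block_damping box_bump T \<tau> K L n constant_on {real n * T<..<real n * T + \<tau> n}"
    and "block_damping box_bump T \<tau> K L n constant_on {real n * T + \<tau> n..real (Suc n) * T - \<tau> n}"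
    and "block_damping box_bump T \<tau> K L n constant_on {real (Suc n) * T - \<tau> n<..<real (Suc n) * T}"
proof -
  let ?\<beta> = "block_damping box_bump T \<tau> K L n"
  have "?\<beta> t = 0" if "t \<in> {real n * T}" for t
    using that assms by (auto simp: block_damping_def box_bump_def algebra_simps)
  then show "?\<beta> constant_on {real n * T}"
    unfolding constant_on_def by blast
  have "?\<beta> t = K n" if "t \<in> {real n * T<..<real n * T + \<tau> n}" for t
    using that assms by (auto simp: block_damping_def box_bump_def algebra_simps)
  then show "?\<beta> constant_on {real n * T<..<real n * T + \<tau> n}"
    unfolding constant_on_def by blast
  have "?\<beta> t = 0" if "t \<in> {real n * T + \<tau> n..real (Suc n) * T - \<tau> n}" for t
    using that assms by (auto simp: block_damping_def box_bump_def algebra_simps)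
  then show "?\<beta> constant_on {real n * T + \<tau> n..real (Suc n) * T - \<tau> n}"
    unfolding constant_on_def by blast
  have "?\<beta> t = L n" if "t \<in> {real (Suc n) * T - \<tau> n<..<real (Suc n) * T}" for t
    using that assms by (auto simp: block_damping_def box_bump_def algebra_simps)
  then show "?\<beta> constant_on {real (Suc n) * T - \<tau> n<..<real (Suc n) * T}"
    unfolding constant_on_def by blast
qed

lemma piecewise_constant_pulsating_damping:
  assumes \<tau>: "\<And>n. 0 < \<tau> n" "\<And>n. 2 * \<tau> n < T"
  shows "piecewise_constant_halfline (pulsating_damping box_bump T \<tau> K L)"
  unfolding piecewise_constant_halfline_def
proof (intro allI impI)
  let ?\<delta> = "pulsating_damping box_bump T \<tau> K L"
  fix J :: "real set" assume J: "is_interval J \<and> bounded J \<and> J \<subseteq> {0..}"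
  have "T > 0"
    using \<tau>[of 0] by simp
  obtain R where R: "\<And>t. t \<in> J \<Longrightarrow> \<bar>t\<bar> \<le> R"
    using J by (auto simp: bounded_iff)
  \<comment> \<open>Points of J lie in blocks of index at most the floor of R / T; the successor
    turns this into a strict bound.\<close>
  define N where "N = Suc (nat \<lfloor>R / T\<rfloor>)"
  \<comment> \<open>A partition of the block without its right end, which is exactly where the
    damping is given by the formula of block n.\<close>
  define P where "P n = {{real n * T}, {real n * T<..<real n * T + \<tau> n},
      {real n * T + \<tau> n..real (Suc n) * T - \<tau> n}, {real (Suc n) * T - \<tau> n<..<real (Suc n) * T}}" for n
  have Pint: "is_interval I" "I \<subseteq> {real n * T..<real (Suc n) * T}"
      "block_damping box_bump T \<tau> K L n constant_on I" if "I \<in> P n" for I n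
    using that \<tau>[of n] \<open>T > 0\<close> block_damping_box_constant_on[of \<tau> n T K L, OF \<tau>]
    by (auto simp: P_def is_interval_1 algebra_simps)
  have cover: "{real n * T..<real (Suc n) * T} \<subseteq> \<Union>(P n)" for n
    using \<tau>[of n] by (auto simp: P_def)
  let ?I = "(\<lambda>I. I \<inter> J) ` (\<Union>n<N. P n)"
  have "finite ?I"
    by (simp add: P_def)
  moreover have "\<Union>?I = J"
  proof
    show "J \<subseteq> \<Union>?I"
    proof
      fix t assume t: "t \<in> J"
      define n where "n = nat \<lfloor>t / T\<rfloor>"
      have "t \<ge> 0"
        using t J by auto
      then have "t / T \<ge> 0"
        using \<open>T > 0\<close> by simp
      then have "real n \<le> t / T" "t / T < real n + 1"
        unfolding n_def by linarith+
      then have "t \<in> {real n * T..<real (Suc n) * T}"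
        using \<open>T > 0\<close> by (auto simp: field_simps)
      moreover have "n < N"
      proof -
        have "t / T \<le> R / T"
          using R[OF t] \<open>T > 0\<close> by (intro divide_right_mono) auto
        then show ?thesis
          unfolding n_def N_def by (simp add: floor_mono nat_mono less_Suc_eq_le)
      qed
      ultimately show "t \<in> \<Union>?I"
        using cover[of n] t by fastforce
    qed
  qed auto
  moreover have "is_interval I \<and> ?\<delta> constant_on I" if mem: "I \<in> ?I" for I
  proof -
    obtain I' where I': "I = I' \<inter> J" "I' \<in> (\<Union>n<N. P n)"
      using mem by (rule imageE)
    from I'(2) obtain n where "I' \<in> P n"
      by (rule UN_E)
    note I = I'(1) this
    have "?\<delta> t = block_damping box_bump T \<tau> K L n t" if "t \<in> I'" for t
      using Pint(2)[OF I(2)] that by (intro pulsating_damping_eq_block[OF \<open>T > 0\<close>]) auto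
    then have "?\<delta> constant_on I"
      using Pint(3)[OF I(2)] by (auto simp: constant_on_def I(1))
    moreover have "is_interval I"
      unfolding I(1) using Pint(1)[OF I(2)] J by (simp add: is_interval_Int)
    ultimately show ?thesis by blast
  qed
  ultimately show "\<exists>\<I>. finite \<I> \<and> \<Union>\<I> = J \<and> (\<forall>I\<in>\<I>. is_interval I \<and> ?\<delta> constant_on I)"
    by (intro exI[of _ ?I] conjI ballI) simp_all
qed

section \<open>Smooth bumps\<close>

text \<open>The classical flat function exp (-1 / x), extended by 0, times a polynomial in 1 / x.
  The polynomial factor makes the family closed under differentiation.\<close>

definition flat :: "real poly \<Rightarrow> real \<Rightarrow> real" where
  "flat p x = (if x > 0 then poly p (1 / x) * exp (- (1 / x)) else 0)"

lemma poly_exp_tendsto_0: "((\<lambda>x. poly p x * exp (- x)) \<longlongrightarrow> (0::real)) at_top"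
proof -
  have "((\<lambda>x. \<Sum>i\<le>degree p. coeff p i * (x ^ i / exp x)) \<longlongrightarrow> (\<Sum>i\<le>degree p. coeff p i * 0)) at_top"
    by (intro tendsto_intros tendsto_power_div_exp_0)
  then show ?thesis
    by (simp add: poly_altdef sum_distrib_right exp_minus divide_inverse mult.assoc)
qed

text \<open>Dividing by h multiplies the polynomial in 1 / h by its variable, which is
  \<open>pCons 0 p\<close>; after the substitution y = 1 / h the exponential wins. This is the
  derivative at 0.\<close>

lemma flat_quotient_tendsto_0: "((\<lambda>h. flat p h / h) \<longlongrightarrow> 0) (at 0)"
proof (rule filterlim_split_at)
  have "\<forall>\<^sub>F h in at_left 0. 0 = flat p h / h"
    unfolding eventually_at_filter by (auto simp: flat_def intro!: always_eventually)
  then show "((\<lambda>h. flat p h / h) \<longlongrightarrow> 0) (at_left 0)"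
    by (rule Lim_transform_eventually[OF tendsto_const])
  have "((\<lambda>h. poly (pCons 0 p) (inverse h) * exp (- inverse h)) \<longlongrightarrow> 0) (at_right 0)"
    by (rule filterlim_compose[OF poly_exp_tendsto_0 filterlim_inverse_at_top_right])
  moreover have "\<forall>\<^sub>F h in at_right 0. poly (pCons 0 p) (inverse h) * exp (- inverse h) = flat p h / h"
    unfolding eventually_at_filter
    by (auto simp: flat_def divide_simps inverse_eq_divide intro!: always_eventually)
  ultimately show "((\<lambda>h. flat p h / h) \<longlongrightarrow> 0) (at_right 0)"
    by (rule Lim_transform_eventually)
qed

text \<open>For x > 0 the chain rule brings out the factor 1 / x^2, encoded by the monomial
  \<open>[:0, 0, 1:]\<close>; p comes from the exponential and -p' from the polynomial.\<close>

lemma DERIV_flat: "(flat p has_real_derivative flat ([:0, 0, 1:] * (p - pderiv p)) x) (at x)"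
proof -
  consider "x > 0" | "x < 0" | "x = 0" by linarith
  then show ?thesis
  proof cases
    case 1
    have "((\<lambda>x. poly p (1 / x) * exp (- (1 / x))) has_real_derivative
        flat ([:0, 0, 1:] * (p - pderiv p)) x) (at x)"
      using 1 by (auto intro!: derivative_eq_intros DERIV_chain'[OF _ poly_DERIV]
          simp: flat_def field_simps power2_eq_square)
    then show ?thesis
      by (rule has_field_derivative_transform_within_open[where S = "{0<..}"])
        (use 1 in \<open>auto simp: flat_def\<close>)
  next
    case 2
    have "((\<lambda>x. 0) has_real_derivative flat ([:0, 0, 1:] * (p - pderiv p)) x) (at x)"
      using 2 by (simp add: flat_def)
    then show ?thesis
      by (rule has_field_derivative_transform_within_open[where S = "{..<0}"])
        (use 2 in \<open>auto simp: flat_def\<close>)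
  next
    case 3
    then show ?thesis
      using flat_quotient_tendsto_0[of p] by (simp add: DERIV_def flat_def)
  qed
qed

text \<open>An algebra of functions closed under differentiation, so smoothness needs no formula for
  higher derivatives. The affine argument allows both t - a and b - t.\<close>

inductive flat_generated :: "(real \<Rightarrow> real) \<Rightarrow> bool" where
  base: "flat_generated (\<lambda>x. flat p (c + k * x))"
| const: "flat_generated (\<lambda>x. c)"
| add: "flat_generated f \<Longrightarrow> flat_generated g \<Longrightarrow> flat_generated (\<lambda>x. f x + g x)"
| mult: "flat_generated f \<Longrightarrow> flat_generated g \<Longrightarrow> flat_generated (\<lambda>x. f x * g x)"

lemma flat_generated_derivative:
  assumes "flat_generated f"
  shows "\<exists>f'. flat_generated f' \<and> (\<forall>x. (f has_real_derivative f' x) (at x))"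
  using assms
proof induction
  case (base p c k)
  let ?q = "[:0, 0, 1:] * (p - pderiv p)"
  have "((\<lambda>x. flat p (c + k * x)) has_real_derivative k * flat ?q (c + k * x)) (at x)" for x
    by (rule DERIV_cong[OF DERIV_chain'[OF _ DERIV_flat]]) (auto intro!: derivative_eq_intros)
  moreover have "flat_generated (\<lambda>x. k * flat ?q (c + k * x))"
    by (intro flat_generated.intros)
  ultimately show ?case by blast
next
  case (const c)
  then show ?case
    using flat_generated.const[of 0] by (intro exI[of _ "\<lambda>_. 0"]) auto
next
  case (add f g)
  then obtain f' g' where "flat_generated f'" "flat_generated g'"
    "\<And>x. (f has_real_derivative f' x) (at x)" "\<And>x. (g has_real_derivative g' x) (at x)"
    by blast
  then show ?case
    by (intro exI[of _ "\<lambda>x. f' x + g' x"]) (auto intro: flat_generated.add DERIV_add)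
next
  case (mult f g)
  then obtain f' g' where "flat_generated f'" "flat_generated g'"
    "\<And>x. (f has_real_derivative f' x) (at x)" "\<And>x. (g has_real_derivative g' x) (at x)"
    by blast
  then show ?case
    using mult.hyps by (intro exI[of _ "\<lambda>x. f' x * g x + g' x * f x"])
      (auto intro: flat_generated.intros DERIV_mult)
qed

text \<open>Each point has a neighbourhood meeting at most two blocks, so locality makes infinite sums of
  bumps superfluous.\<close>

definition locally_flat_generated :: "(real \<Rightarrow> real) \<Rightarrow> bool" where
  "locally_flat_generated f \<longleftrightarrow>
     (\<forall>x\<ge>0. \<exists>g e. flat_generated g \<and> e > 0 \<and> (\<forall>y\<ge>0. \<bar>y - x\<bar> < e \<longrightarrow> f y = g y))"

text \<open>Near each point f coincides with a generated function, so its one-sided or two-sided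
  derivative there is the derivative of that function, which is generated again. Iteration yields
  all derivatives.\<close>

lemma locally_flat_generated_hderiv:
  assumes "locally_flat_generated f"
  shows "f differentiable_on {0..} \<and> locally_flat_generated (hderiv f)"
proof -
  have *: "\<exists>g' e. flat_generated g' \<and> e > 0 \<and>
      (\<forall>y\<ge>0. \<bar>y - x\<bar> < e \<longrightarrow> (f has_real_derivative g' y) (at y within {0..}))" if x: "x \<ge> 0" for x
  proof -
    obtain g e where g: "flat_generated g" "e > 0" "\<And>y. y \<ge> 0 \<Longrightarrow> \<bar>y - x\<bar> < e \<Longrightarrow> f y = g y"
      using assms x unfolding locally_flat_generated_def by blast
    obtain g' where g': "flat_generated g'" "\<And>x. (g has_real_derivative g' x) (at x)"
      using flat_generated_derivative[OF g(1)] by blast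
    have "(f has_real_derivative g' y) (at y within {0..})" if y: "y \<ge> 0" "\<bar>y - x\<bar> < e" for y
    proof (rule has_field_derivative_transform_within)
      show "(g has_real_derivative g' y) (at y within {0..})"
        using g'(2) by (rule has_field_derivative_at_within)
      \<comment> \<open>With this radius the ball around y stays inside the ball around x where f
        and g agree.\<close>
      show "0 < e - \<bar>y - x\<bar>" "y \<in> {0..}"
        using y by auto
      show "g z = f z" if "z \<in> {0..}" "dist z y < e - \<bar>y - x\<bar>" for z
      proof (rule g(3)[symmetric])
        show "0 \<le> z" "\<bar>z - x\<bar> < e"
          using that by (auto simp: dist_real_def)
      qed
    qed
    with g'(1) g(2) show ?thesis by blast
  qed
  have "f differentiable (at x within {0..})" if x: "x \<in> {0..}" for x
  proof -
    obtain g' e where "e > 0" "\<forall>y\<ge>0. \<bar>y - x\<bar> < e \<longrightarrow> (f has_real_derivative g' y) (at y within {0..})"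
      using * x by (meson atLeast_iff)
    then have "(f has_real_derivative g' x) (at x within {0..})"
      using x by simp
    then show ?thesis
      by (auto simp: has_field_derivative_def differentiable_def)
  qed
  then have "f differentiable_on {0..}"
    by (simp add: differentiable_on_def)
  moreover have "locally_flat_generated (hderiv f)"
    unfolding locally_flat_generated_def
  proof (intro allI impI)
    fix x :: real assume "x \<ge> 0"
    then obtain g' e where "flat_generated g'" "e > 0"
      and der: "\<And>y. y \<ge> 0 \<Longrightarrow> \<bar>y - x\<bar> < e \<Longrightarrow> (f has_real_derivative g' y) (at y within {0..})"
      using * by meson
    then show "\<exists>g e. flat_generated g \<and> e > 0 \<and> (\<forall>y\<ge>0. \<bar>y - x\<bar> < e \<longrightarrow> hderiv f y = g y)"
      using hderiv_eqI by blast
  qed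
  ultimately show ?thesis ..
qed

lemma smooth_halfline_locally_flat_generated:
  assumes "locally_flat_generated f"
  shows "smooth_halfline f"
proof -
  have "locally_flat_generated ((hderiv ^^ n) f)" for n
    by (induction n) (use assms locally_flat_generated_hderiv in auto)
  then show ?thesis
    unfolding smooth_halfline_def using locally_flat_generated_hderiv by blast
qed

section \<open>The smooth damping\<close>

text \<open>The product exp (-1 / (t - a)) exp (-1 / (b - t)) inside the interval and 0 outside. The
  affine arguments are spelled so as to match the rule \<open>base\<close>.\<close>

definition smooth_bump :: "real \<Rightarrow> real \<Rightarrow> real \<Rightarrow> real" where
  "smooth_bump a b t = flat 1 (- a + 1 * t) * flat 1 (b + (- 1) * t)"

lemma flat_generated_smooth_bump: "flat_generated (smooth_bump a b)"
  unfolding smooth_bump_def by (intro flat_generated.intros)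

lemma bump_family_smooth: "bump_family smooth_bump"
  unfolding bump_family_def
proof (intro allI impI conjI)
  fix a b :: real assume "a < b"
  show "0 \<le> smooth_bump a b t" for t
    by (simp add: smooth_bump_def flat_def)
  show "smooth_bump a b t = 0" if "t \<notin> {a<..<b}" for t
    using that by (auto simp: smooth_bump_def flat_def)
  obtain g' where "\<And>x. (smooth_bump a b has_real_derivative g' x) (at x)"
    using flat_generated_derivative[OF flat_generated_smooth_bump] by blast
  then have "continuous_on {a..b} (smooth_bump a b)"
    by (meson DERIV_continuous continuous_at_imp_continuous_on)
  moreover have "0 < integral {a..b} (smooth_bump a b)"
    using integral_less_real[OF continuous_on_const[of _ 0] calculation] \<open>a < b\<close>
    by (simp add: smooth_bump_def flat_def)
  ultimately show "\<exists>d. continuous_on {a..b} d \<and> (\<forall>t\<in>{a<..<b}. smooth_bump a b t = d t) \<and> 0 < integral {a..b} d"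
    by blast
qed

lemma flat_generated_block_damping: "flat_generated (block_damping smooth_bump T \<tau> K L n)"
  unfolding block_damping_def by (intro flat_generated.intros flat_generated_smooth_bump)

lemma smooth_pulsating_damping:
  assumes \<tau>: "\<And>n. 0 < \<tau> n" "\<And>n. 2 * \<tau> n < T"
  shows "smooth_halfline (pulsating_damping smooth_bump T \<tau> K L)"
proof (rule smooth_halfline_locally_flat_generated)
  let ?\<delta> = "pulsating_damping smooth_bump T \<tau> K L" and ?\<beta> = "block_damping smooth_bump T \<tau> K L"
  have "T > 0"
    using \<tau>[of 0] by simp
  have zero: "?\<beta> n t = 0" if "t \<notin> {real n * T<..<real (Suc n) * T}" for n t
    using bump_family_smooth \<tau> that by (rule block_damping_outside)
  have eq: "?\<delta> t = ?\<beta> n t" if "real n * T \<le> t" "t < real (Suc n) * T" for n t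
    using pulsating_damping_eq_block[OF \<open>T > 0\<close> that] .
  show "locally_flat_generated ?\<delta>"
    unfolding locally_flat_generated_def
  proof (intro allI impI)
    fix x :: real assume "x \<ge> 0"
    define n where "n = nat \<lfloor>x / T\<rfloor>"
    have "x / T \<ge> 0"
      using \<open>x \<ge> 0\<close> \<open>T > 0\<close> by simp
    then have "real n \<le> x / T" "x / T < real n + 1"
      unfolding n_def by linarith+
    then have x: "real n * T \<le> x" "x < real (Suc n) * T"
      using \<open>T > 0\<close> by (auto simp: field_simps)
    show "\<exists>g e. flat_generated g \<and> e > 0 \<and> (\<forall>y\<ge>0. \<bar>y - x\<bar> < e \<longrightarrow> ?\<delta> y = g y)"
    \<comment> \<open>Block 0 has no left neighbour, but only y \<ge> 0 matters, so one formula
      suffices near its points.\<close>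
    proof (cases n)
      case 0
      then have "?\<delta> y = ?\<beta> 0 y" if "y \<ge> 0" "\<bar>y - x\<bar> < T - x" for y
        using eq[of 0 y] that by simp
      moreover have "T - x > 0"
        using x 0 by simp
      ultimately show ?thesis
        using flat_generated_block_damping by blast
    next
      case (Suc m)
      \<comment> \<open>Within this radius y lies in block m or Suc m, and the formula of the other
        block vanishes there. The sum therefore represents the damping on both sides of the common
        endpoint.\<close>
      have "?\<delta> y = ?\<beta> m y + ?\<beta> (Suc m) y" if y: "\<bar>y - x\<bar> < min T (real (Suc n) * T - x)" for y
      proof -
        have y': "real m * T \<le> y" "y < real (Suc (Suc m)) * T"
          using x y by (auto simp: Suc algebra_simps abs_less_iff)
        show ?thesis
        proof (cases "real (Suc m) * T \<le> y")
          case True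
          then show ?thesis
            using eq[of "Suc m" y] zero[of y m] y' by simp
        next
          case False
          then show ?thesis
            using eq[of m y] zero[of y "Suc m"] y' by simp
        qed
      qed
      moreover have "flat_generated (\<lambda>y. ?\<beta> m y + ?\<beta> (Suc m) y)"
        by (intro flat_generated.add flat_generated_block_damping)
      moreover have "min T (real (Suc n) * T - x) > 0"
        using x \<open>T > 0\<close> by simp
      ultimately show ?thesis by blast
    qed
  qed
qed

theorem theorem2p2:
  fixes lam t\<^sub>0 :: real and \<phi> :: "real \<Rightarrow> real"
  assumes "lam > 0"
    and "\<And>t. t \<ge> 0 \<Longrightarrow> \<phi> t > 0"
    and "antimono_on {0..} \<phi>"
    and "t\<^sub>0 = pi / (2 * lam)"
  shows "(\<exists>\<delta>. (\<forall>t\<ge>0. \<delta> t \<ge> 0) \<and> decays_at_rate lam \<phi> t\<^sub>0 \<delta>) \<and>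
         (\<exists>\<delta>. (\<forall>t\<ge>0. \<delta> t \<ge> 0) \<and> smooth_halfline \<delta> \<and> decays_at_rate lam \<phi> t\<^sub>0 \<delta>) \<and>
         (\<exists>\<delta>. (\<forall>t\<ge>0. \<delta> t \<ge> 0) \<and> piecewise_constant_halfline \<delta> \<and> decays_at_rate lam \<phi> t\<^sub>0 \<delta>)"
proof -
  obtain \<tau> K L where 1: "\<And>n. 0 < \<tau> n" "\<And>n. 2 * \<tau> n < t\<^sub>0" "\<And>n. 0 \<le> K n" "\<And>n. 0 \<le> L n"
      "decays_at_rate lam \<phi> t\<^sub>0 (pulsating_damping smooth_bump t\<^sub>0 \<tau> K L)"
    using pulsating_damping_decay[OF bump_family_smooth assms] by blast
  have smooth: "\<exists>\<delta>. (\<forall>t\<ge>0. \<delta> t \<ge> 0) \<and> smooth_halfline \<delta> \<and> decays_at_rate lam \<phi> t\<^sub>0 \<delta>"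
    using pulsating_damping_nonneg[of _ \<tau> K L t\<^sub>0, OF bump_family_smooth 1(1,3,4)] smooth_pulsating_damping[of \<tau> t\<^sub>0 K L, OF 1(1,2)] 1(5)
    by blast
  \<comment> \<open>The amplitudes are obtained afresh, since they depend on the integral of the
    profile.\<close>
  obtain \<tau> K L where 2: "\<And>n. 0 < \<tau> n" "\<And>n. 2 * \<tau> n < t\<^sub>0" "\<And>n. 0 \<le> K n" "\<And>n. 0 \<le> L n"
      "decays_at_rate lam \<phi> t\<^sub>0 (pulsating_damping box_bump t\<^sub>0 \<tau> K L)"
    using pulsating_damping_decay[OF bump_family_box assms] by blast
  have "\<exists>\<delta>. (\<forall>t\<ge>0. \<delta> t \<ge> 0) \<and> piecewise_constant_halfline \<delta> \<and> decays_at_rate lam \<phi> t\<^sub>0 \<delta>"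
    using pulsating_damping_nonneg[of _ \<tau> K L t\<^sub>0, OF bump_family_box 2(1,3,4)]
      piecewise_constant_pulsating_damping[of \<tau> t\<^sub>0 K L, OF 2(1,2)] 2(5)
    by blast
  with smooth show ?thesis by blast
qed

end
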